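(* Let $p$ be a positive prime and let $\mathcal{A}$ be a set of nonnegative integers with $|\mathcal{A}| = p$. Suppose that $\mathcal{A}$ is not of the form \[ \mathcal{A} = \{a + i p^{s} + k_{i} p^{s+1} : i = 0, \dots, p-1\}, \] where $a > 0$, $s \ge 0$ and $k_{i}$ ($0 \le i \le p-1$) are integers (that is, there are no integers $a>0$, $s \ge 0$, $k_0,\dots,k_{p-1}$ for which this equality holds). Then, for any additive complement $\mathcal{B}$ of $\mathcal{A}$, we have \[ \lim_{x \to +\infty} \bigl(A(x)B(x) - x\bigr) = +\infty . \]
   Context: For sets $\mathcal{A}$, $\mathcal{B}$ of nonnegative integers, the counting functions are $A(x) = |\{a \in \mathcal{A} : a \le x\}|$ and $B(x) = |\{b \in \mathcal{B} : b \le x\}|$. A set $\mathcal{B}$ of nonnegative integers is an additive complement of $\mathcal{A}$ if every sufficiently large positive integer $n$ can be represented in the form $n = a + b$ with $a \in \mathcal{A}$, $b \in \mathcal{B}$. The integers $k_i$ may be negative. *)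

theory Defs
  imports Complex_Main "HOL-Computational_Algebra.Primes"
begin

definition counting :: "nat set \<Rightarrow> real \<Rightarrow> nat" where
  "counting A x = card {a \<in> A. real a \<le> x}"

definition additive_complement :: "nat set \<Rightarrow> nat set \<Rightarrow> bool" where
  "additive_complement A B \<longleftrightarrow>
     (\<forall>\<^sub>F n in sequentially. \<exists>a\<in>A. \<exists>b\<in>B. n = a + b)"

end

theory Submission
  imports Defs "HOL-Computational_Algebra.Formal_Power_Series"
begin

text \<open>
  Let \<open>r(n)\<close> be the number of representations \<open>n = a + b\<close>. Summing \<open>r\<close> over \<open>n \<le> N\<close> counts pairs
  \<open>(a, b)\<close> with \<open>b \<le> N\<close>, so \<open>A(N) B(N) - N\<close> is, up to a bounded error, at least the number of
  \<open>n \<le> N\<close> with \<open>r(n) \<ge> 2\<close>. If it does not tend to infinity, then \<open>r(n) = 1\<close> for all large \<open>n\<close>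
  (lemma \<open>surplus_tends_to_infinity\<close>): up to finitely many exceptions, \<open>A\<close> and \<open>B\<close> tile the
  nonnegative integers. It remains to see that a set of prime size \<open>p\<close> which tiles in this sense has
  the excluded form.

  Write \<open>A(X)\<close> and \<open>B(X)\<close> for the generating functions. The product \<open>A(X) B(X)\<close> has eventually
  constant coefficients \<open>1\<close>; multiplying by \<open>A(X)\<close> another \<open>p - 1\<close> times makes the coefficients of
  \<open>A(X)\<^sup>p B(X)\<close> eventually equal to \<open>p\<^sup>p\<^sup>-\<^sup>1\<close>, which is divisible by \<open>p\<close>. Since
  \<open>A(X)\<^sup>p \<equiv> A(X\<^sup>p)\<close> modulo \<open>p\<close>, the number of \<open>a \<in> A\<close> with \<open>n - pa \<in> B\<close> is divisible by \<open>p\<close> for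
  all large \<open>n\<close>. It lies between \<open>0\<close> and \<open>p\<close>, so either none or all of the numbers \<open>n - pa\<close> lie
  in \<open>B\<close>. Hence \<open>p(a - a')\<close> is an eventual period of \<open>B\<close> for all \<open>a, a' \<in> A\<close>
  (lemma \<open>eventual_period_p_difference\<close>), whereas \<open>a - a'\<close> itself is not an eventual period when
  \<open>a \<noteq> a'\<close>, because representations are unique.

  The eventual periods form a subgroup \<open>t\<int>\<close>, so \<open>t\<close> divides \<open>p(a - a')\<close> but not \<open>a - a'\<close>. If
  \<open>p\<^sup>s\<^sup>+\<^sup>1\<close> is the exact power of \<open>p\<close> in \<open>t\<close>, this forces all elements of \<open>A\<close> to be congruent modulo
  \<open>p\<^sup>s\<close> and pairwise incongruent modulo \<open>p\<^sup>s\<^sup>+\<^sup>1\<close>. As there are \<open>p\<close> of them, they fill all the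
  residue classes \<open>a + i p\<^sup>s\<close> modulo \<open>p\<^sup>s\<^sup>+\<^sup>1\<close> (lemma \<open>prime_power_progression\<close>).
\<close>

section \<open>Representations and the growth of the surplus\<close>

definition reps :: "nat set \<Rightarrow> nat set \<Rightarrow> nat \<Rightarrow> nat set" where
  "reps A B n = {a \<in> A. a \<le> n \<and> n - a \<in> B}"

lemma finite_reps: "finite A \<Longrightarrow> finite (reps A B n)"
  by (simp add: reps_def)

lemma additive_complement_reps:
  assumes "additive_complement A B"
  obtains n0 where "\<And>n. n \<ge> n0 \<Longrightarrow> reps A B n \<noteq> {}"
proof -
  obtain n0 where n0: "\<And>n. n \<ge> n0 \<Longrightarrow> \<exists>a\<in>A. \<exists>b\<in>B. n = a + b"
    using assms unfolding additive_complement_def eventually_sequentially by blast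
  have "reps A B n \<noteq> {}" if n: "n \<ge> n0" for n
  proof -
    obtain a b where "a \<in> A" "b \<in> B" "n = a + b" using n0[OF n] by blast
    then have "a \<in> reps A B n" by (simp add: reps_def)
    then show ?thesis by blast
  qed
  then show ?thesis using that by blast
qed

lemma sum_card_reps_le:
  assumes "finite A"
  shows "(\<Sum>n\<le>N. card (reps A B n)) \<le> card A * card {b \<in> B. b \<le> N}"
proof -
  let ?S = "SIGMA n:{..N}. reps A B n"
  have "(\<Sum>n\<le>N. card (reps A B n)) = card ?S"
    using assms by (simp add: card_SigmaI finite_reps)
  also have "\<dots> \<le> card (A \<times> {b \<in> B. b \<le> N})"
  proof (rule card_inj_on_le)
    show "inj_on (\<lambda>(n, a). (a, n - a)) ?S"
      by (auto simp: inj_on_def reps_def)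
    show "(\<lambda>(n, a). (a, n - a)) ` ?S \<subseteq> A \<times> {b \<in> B. b \<le> N}"
      by (auto simp: reps_def)
    show "finite (A \<times> {b \<in> B. b \<le> N})"
      using assms by simp
  qed
  also have "\<dots> = card A * card {b \<in> B. b \<le> N}"
    by (rule card_cartesian_product)
  finally show ?thesis .
qed

text \<open>
  Each \<open>n\<close> with a second representation contributes at least \<open>1\<close> to the surplus \<open>A(N) B(N) - N\<close>; only
  the finitely many \<open>n\<close> without any representation count against it.
\<close>

lemma surplus_tends_to_infinity:
  fixes A B :: "nat set"
  assumes A: "finite A"
    and compl: "additive_complement A B"
    and inf: "infinite {n. card (reps A B n) \<ge> 2}"
  shows "filterlim (\<lambda>x::real. real (counting A x) * real (counting B x) - x) at_top at_top"
  unfolding filterlim_at_top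
proof
  fix Z :: real
  obtain n0 where n0: "\<And>n. n \<ge> n0 \<Longrightarrow> reps A B n \<noteq> {}"
    using additive_complement_reps[OF compl] by blast
  let ?E = "{n. card (reps A B n) \<ge> 2} - {..<n0}"
  have "infinite ?E"
    using inf by (rule Diff_infinite_finite[rotated]) simp
  then obtain D where D: "finite D" "card D = n0 + nat \<lceil>Z\<rceil>" "D \<subseteq> ?E"
    using infinite_arbitrarily_large by blast
  obtain M where M: "\<And>m. m \<in> A \<union> D \<Longrightarrow> m \<le> M"
    using A D(1) finite_nat_set_iff_bounded_le[of "A \<union> D"] by auto
  have "real (counting A x) * real (counting B x) - x \<ge> Z" if x: "x \<ge> real M" for x
  proof -
    define N where "N = nat \<lfloor>x\<rfloor>"
    have "x \<ge> 0" using x by linarith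
    then have le_N: "real m \<le> x \<longleftrightarrow> m \<le> N" for m :: nat
      by (auto simp: N_def le_nat_iff le_floor_iff)
    have "M \<le> N" using x le_N by blast
    have cA: "counting A x = card A"
      unfolding counting_def le_N using M \<open>M \<le> N\<close> by (intro arg_cong[of _ _ card]) force
    have cB: "counting B x = card {b \<in> B. b \<le> N}"
      unfolding counting_def le_N ..
    have "N + 1 + card D = (\<Sum>n\<le>N. 1 + of_bool (n \<in> D))"
    proof -
      have "{..N} \<inter> D = D" using M \<open>M \<le> N\<close> by force
      then show ?thesis by (simp only: sum.distrib of_bool_def) (simp add: sum.If_cases)
    qed
    also have "\<dots> \<le> (\<Sum>n\<le>N. card (reps A B n) + of_bool (n < n0))"
    proof (rule sum_mono)
      fix n
      have "card (reps A B n) \<ge> 1" if "n \<ge> n0"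
        using n0[OF that] finite_reps[OF A] by (simp add: Suc_le_eq card_gt_0_iff)
      moreover have "n \<ge> n0 \<and> card (reps A B n) \<ge> 2" if "n \<in> D"
        using that D(3) by auto
      ultimately show "1 + of_bool (n \<in> D) \<le> card (reps A B n) + (of_bool (n < n0) :: nat)"
        by (cases "n \<in> D"; cases "n < n0") auto
    qed
    also have "\<dots> = (\<Sum>n\<le>N. card (reps A B n)) + card ({..N} \<inter> {..<n0})"
      by (simp only: sum.distrib of_bool_def) (simp add: sum.If_cases lessThan_def)
    also have "\<dots> \<le> card A * card {b \<in> B. b \<le> N} + n0"
      using sum_card_reps_le[OF A, of B N] card_mono[of "{..<n0}" "{..N} \<inter> {..<n0}"] by simp
    finally have "N + 1 + nat \<lceil>Z\<rceil> \<le> card A * card {b \<in> B. b \<le> N}"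
      using D(2) by simp
    then have "real (N + 1 + nat \<lceil>Z\<rceil>) \<le> real (counting A x * counting B x)"
      unfolding cA cB by (simp only: of_nat_le_iff)
    then have "real N + 1 + real (nat \<lceil>Z\<rceil>) \<le> real (counting A x) * real (counting B x)"
      by simp
    moreover have "x \<le> real N + 1" using \<open>x \<ge> 0\<close> unfolding N_def by linarith
    moreover have "Z \<le> real (nat \<lceil>Z\<rceil>)" by linarith
    ultimately show ?thesis by linarith
  qed
  then show "\<forall>\<^sub>F x in at_top. Z \<le> real (counting A x) * real (counting B x) - x"
    unfolding eventually_at_top_linorder by blast
qed

section \<open>Generating functions modulo a prime\<close>

text \<open>
  The Frobenius congruence, stated as divisibility by \<open>of_nat p\<close> so that it applies to integral
  power series.
\<close>

lemma prime_dvd_add_power: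
  fixes x y :: "'a :: comm_ring_1"
  assumes "prime p"
  shows "of_nat p dvd (x + y) ^ p - (x ^ p + y ^ p)"
proof -
  have "p > 0" using assms by (rule prime_gt_0_nat)
  have "(x + y) ^ p = (\<Sum>k\<le>p. of_nat (p choose k) * x ^ k * y ^ (p - k))"
    by (rule binomial_ring)
  also have "{..p} = insert 0 (insert p {0<..<p})"
    using \<open>p > 0\<close> by auto
  also have "(\<Sum>k\<in>\<dots>. of_nat (p choose k) * x ^ k * y ^ (p - k)) =
      y ^ p + (x ^ p + (\<Sum>k\<in>{0<..<p}. of_nat (p choose k) * x ^ k * y ^ (p - k)))"
    using \<open>p > 0\<close> by simp
  finally have eq: "(x + y) ^ p - (x ^ p + y ^ p) =
      (\<Sum>k\<in>{0<..<p}. of_nat (p choose k) * x ^ k * y ^ (p - k))"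
    by simp
  show ?thesis
    unfolding eq
  proof (rule dvd_sum)
    fix k assume "k \<in> {0<..<p}"
    then have "p dvd p choose k"
      using assms by (intro dvd_choose_prime) auto
    then have "(of_nat p :: 'a) dvd of_nat (p choose k)"
      by (metis dvdE dvd_triv_left of_nat_mult)
    then show "(of_nat p :: 'a) dvd of_nat (p choose k) * x ^ k * y ^ (p - k)"
      by (simp add: mult.assoc)
  qed
qed

lemma prime_dvd_sum_power:
  fixes f :: "'b \<Rightarrow> 'a :: comm_ring_1"
  assumes "prime p" "finite S"
  shows "of_nat p dvd (\<Sum>i\<in>S. f i) ^ p - (\<Sum>i\<in>S. f i ^ p)"
  using assms(2)
proof (induction S rule: finite_induct)
  case empty
  then show ?case using prime_gt_0_nat[OF assms(1)] by (simp add: power_0_left)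
next
  case (insert a S)
  have "of_nat p dvd ((f a + (\<Sum>i\<in>S. f i)) ^ p - (f a ^ p + (\<Sum>i\<in>S. f i) ^ p))
      + ((\<Sum>i\<in>S. f i) ^ p - (\<Sum>i\<in>S. f i ^ p))"
    by (intro dvd_add prime_dvd_add_power assms(1) insert.IH)
  then show ?case using insert.hyps by (simp add: algebra_simps)
qed

definition set_fps :: "nat set \<Rightarrow> int fps" where
  "set_fps B = Abs_fps (\<lambda>n. of_bool (n \<in> B))"

lemma set_fps_nth [simp]: "fps_nth (set_fps B) n = of_bool (n \<in> B)"
  by (simp add: set_fps_def)

text \<open>
  Dilating the exponents by \<open>c\<close> covers both \<open>A(X) B(X)\<close> (for \<open>c = 1\<close>) and \<open>A(X\<^sup>p) B(X)\<close>
  (for \<open>c = p\<close>).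
\<close>

lemma dilated_product_nth:
  assumes "finite A"
  shows "fps_nth ((\<Sum>a\<in>A. fps_X ^ (c * a)) * set_fps B) n =
    int (card {a \<in> A. c * a \<le> n \<and> n - c * a \<in> B})"
proof -
  have "fps_nth ((\<Sum>a\<in>A. fps_X ^ (c * a)) * set_fps B) n =
      (\<Sum>a\<in>A. of_bool (c * a \<le> n \<and> n - c * a \<in> B))"
    by (auto simp: sum_distrib_right fps_sum_nth fps_X_power_mult_nth intro!: sum.cong)
  also have "\<dots> = int (card (A \<inter> {a. c * a \<le> n \<and> n - c * a \<in> B}))"
    using assms by simp
  finally show ?thesis by (simp add: Int_def)
qed

text \<open>
  Each factor \<open>A(X)\<close> multiplies the limiting coefficient by \<open>A(1)\<close>.
\<close>

lemma power_mult_eventually_constant: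
  fixes G :: "int fps"
  assumes "\<forall>\<^sub>F n in sequentially. fps_nth G n = c"
  shows "\<forall>\<^sub>F n in sequentially.
    fps_nth ((\<Sum>a\<in>A. fps_X ^ a) ^ k * G) n = int (card A) ^ k * c"
proof (cases "finite A")
  case False
  then show ?thesis using assms by (cases k) simp_all
next
  case A: True
  show ?thesis
  proof (induction k)
    case 0
    then show ?case using assms by simp
  next
    case (Suc k)
    let ?F = "(\<Sum>a\<in>A. fps_X ^ a) ^ k * G"
    obtain N where N: "\<And>n. n \<ge> N \<Longrightarrow> fps_nth ?F n = int (card A) ^ k * c"
      using Suc.IH unfolding eventually_sequentially by blast
    obtain M where M: "\<And>a. a \<in> A \<Longrightarrow> a \<le> M"
      using A finite_nat_set_iff_bounded_le[of A] by auto
    have "fps_nth ((\<Sum>a\<in>A. fps_X ^ a) ^ Suc k * G) n = int (card A) ^ Suc k * c"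
      if n: "n \<ge> N + M" for n
    proof -
      have "fps_nth ((\<Sum>a\<in>A. fps_X ^ a) ^ Suc k * G) n = fps_nth ((\<Sum>a\<in>A. fps_X ^ a) * ?F) n"
        by (simp add: mult.assoc)
      also have "\<dots> = (\<Sum>a\<in>A. fps_nth (fps_X ^ a * ?F) n)"
        by (simp only: sum_distrib_right fps_sum_nth)
      also have "\<dots> = (\<Sum>a\<in>A. int (card A) ^ k * c)"
      proof (rule sum.cong)
        fix a assume "a \<in> A"
        then have "a \<le> n" "n - a \<ge> N" using M[of a] n by auto
        then show "fps_nth (fps_X ^ a * ?F) n = int (card A) ^ k * c"
          using N by (simp only: fps_X_power_mult_nth not_less if_False flip: not_le) simp
      qed simp
      finally show ?thesis by simp
    qed
    then show ?case unfolding eventually_sequentially by blast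
  qed
qed

text \<open>
  The number of \<open>a \<in> A\<close> with \<open>n - pa \<in> B\<close> is the coefficient of \<open>X\<^sup>n\<close> in \<open>A(X\<^sup>p) B(X)\<close>, which is
  congruent modulo \<open>p\<close> to that of \<open>A(X)\<^sup>p\<^sup>-\<^sup>1 \<cdot> A(X) B(X)\<close>, for large \<open>n\<close> equal to
  \<open>p\<^sup>p\<^sup>-\<^sup>1\<close>. So it is a multiple of \<open>p\<close>, and being at most \<open>|A| = p\<close> it is \<open>0\<close> or \<open>p\<close>.
\<close>

lemma dilated_all_or_none:
  fixes A B :: "nat set"
  assumes p: "prime p" and cardA: "card A = p"
    and tiling: "\<forall>\<^sub>F n in sequentially. card (reps A B n) = 1"
  shows "\<forall>\<^sub>F n in sequentially.
    {a \<in> A. p * a \<le> n \<and> n - p * a \<in> B} \<in> {{}, A}"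
proof -
  have A: "finite A" using cardA prime_gt_0_nat[OF p] by (metis card.infinite less_irrefl)
  let ?A = "\<Sum>a\<in>A. fps_X ^ a :: int fps"
  have "fps_nth (?A * set_fps B) n = int (card (reps A B n))" for n
    using dilated_product_nth[OF A, of 1 B n] by (simp add: reps_def)
  then have "\<forall>\<^sub>F n in sequentially. fps_nth (?A * set_fps B) n = 1"
    using tiling by simp
  then have "\<forall>\<^sub>F n in sequentially.
      fps_nth (?A ^ (p - 1) * (?A * set_fps B)) n = int (card A) ^ (p - 1) * 1"
    by (rule power_mult_eventually_constant)
  then show ?thesis
  proof (rule eventually_mono)
    fix n assume n: "fps_nth (?A ^ (p - 1) * (?A * set_fps B)) n = int (card A) ^ (p - 1) * 1"
    have "?A ^ (p - 1) * (?A * set_fps B) = ?A ^ p * set_fps B"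
      using prime_gt_0_nat[OF p] by (cases p) (simp_all add: algebra_simps)
    then have 1: "int p dvd fps_nth (?A ^ p * set_fps B) n"
      using n cardA prime_gt_1_nat[OF p] by (simp only: mult_1_right) (simp add: dvd_power)
    obtain H where H: "?A ^ p - (\<Sum>a\<in>A. (fps_X ^ a) ^ p) = of_nat p * H"
      using prime_dvd_sum_power[OF p A, of "\<lambda>a. fps_X ^ a :: int fps"] by (elim dvdE)
    have "(\<Sum>a\<in>A. fps_X ^ (p * a)) * set_fps B = ?A ^ p * set_fps B - of_nat p * (H * set_fps B)"
      using H by (simp add: algebra_simps flip: power_mult)
    then have "int (card {a \<in> A. p * a \<le> n \<and> n - p * a \<in> B}) =
        fps_nth (?A ^ p * set_fps B) n - int p * fps_nth (H * set_fps B) n"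
      by (simp add: fps_of_nat[symmetric] flip: dilated_product_nth[OF A])
    then have "int p dvd int (card {a \<in> A. p * a \<le> n \<and> n - p * a \<in> B})"
      using 1 by simp
    then have dvd: "p dvd card {a \<in> A. p * a \<le> n \<and> n - p * a \<in> B}"
      by simp
    have sub: "{a \<in> A. p * a \<le> n \<and> n - p * a \<in> B} \<subseteq> A" by blast
    show "{a \<in> A. p * a \<le> n \<and> n - p * a \<in> B} \<in> {{}, A}"
    proof (cases "{a \<in> A. p * a \<le> n \<and> n - p * a \<in> B} = {}")
      case False
      then have "card {a \<in> A. p * a \<le> n \<and> n - p * a \<in> B} > 0"
        using A by (simp add: card_gt_0_iff)
      with dvd have "card A \<le> card {a \<in> A. p * a \<le> n \<and> n - p * a \<in> B}"
        using cardA by (simp add: dvd_imp_le)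
      then have "{a \<in> A. p * a \<le> n \<and> n - p * a \<in> B} = A"
        using card_seteq[OF A sub] by blast
      then show ?thesis by blast
    qed blast
  qed
qed

section \<open>Eventual periods\<close>

text \<open>
  Periods are taken in the integers, where they form a group.
\<close>

definition eventual_periods :: "nat set \<Rightarrow> int set" where
  "eventual_periods B = {t. \<exists>N. \<forall>b\<ge>N. b + t \<in> int ` B \<longleftrightarrow> b \<in> int ` B}"

lemma eventual_periods_diff:
  assumes "t \<in> eventual_periods B" "u \<in> eventual_periods B"
  shows "t - u \<in> eventual_periods B"
proof -
  obtain N M where N: "\<And>b. b \<ge> N \<Longrightarrow> b + t \<in> int ` B \<longleftrightarrow> b \<in> int ` B"
    and M: "\<And>b. b \<ge> M \<Longrightarrow> b + u \<in> int ` B \<longleftrightarrow> b \<in> int ` B"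
    using assms unfolding eventual_periods_def by blast
  have "b + (t - u) \<in> int ` B \<longleftrightarrow> b \<in> int ` B" if "b \<ge> max N M + \<bar>u\<bar>" for b
    using that N[of "b - u"] M[of "b - u"] by (simp add: algebra_simps)
  then show ?thesis unfolding eventual_periods_def by blast
qed

lemma eventual_period_p_difference:
  fixes A B :: "nat set"
  assumes p: "prime p" and cardA: "card A = p"
    and tiling: "\<forall>\<^sub>F n in sequentially. card (reps A B n) = 1"
    and a: "a \<in> A" "a' \<in> A"
  shows "int p * (int a - int a') \<in> eventual_periods B"
proof -
  obtain N where N: "\<And>n. n \<ge> N \<Longrightarrow> {a \<in> A. p * a \<le> n \<and> n - p * a \<in> B} \<in> {{}, A}"
    using dilated_all_or_none[OF p cardA tiling] unfolding eventually_sequentially by blast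
  \<comment> \<open>Here \<open>n = b + p c\<close> is the common value of \<open>b + p c\<close> and \<open>(b + p (c - c')) + p c'\<close>.\<close>
  have shift: "b + int p * (int c - int c') \<in> int ` B"
    if "b \<in> int ` B" "b \<ge> int N" "c \<in> A" "c' \<in> A" for b c c'
  proof -
    obtain m where m: "b = int m" "m \<in> B" using \<open>b \<in> int ` B\<close> by blast
    have "c \<in> {a \<in> A. p * a \<le> m + p * c \<and> m + p * c - p * a \<in> B}"
      using m \<open>c \<in> A\<close> by simp
    moreover have "N \<le> m + p * c" using \<open>b \<ge> int N\<close> m by simp
    ultimately have "{a \<in> A. p * a \<le> m + p * c \<and> m + p * c - p * a \<in> B} = A"
      using N[of "m + p * c"] by blast
    then have "p * c' \<le> m + p * c" "m + p * c - p * c' \<in> B" using \<open>c' \<in> A\<close> by blast+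
    moreover have "b + int p * (int c - int c') = int (m + p * c - p * c')"
      using \<open>p * c' \<le> m + p * c\<close> m by (simp add: of_nat_diff algebra_simps)
    ultimately show ?thesis by blast
  qed
  have "b + int p * (int a - int a') \<in> int ` B \<longleftrightarrow> b \<in> int ` B"
    if b: "b \<ge> int N + \<bar>int p * (int a - int a')\<bar>" for b
  proof
    assume "b \<in> int ` B"
    then show "b + int p * (int a - int a') \<in> int ` B" using shift a b by simp
  next
    assume "b + int p * (int a - int a') \<in> int ` B"
    then have "b + int p * (int a - int a') + int p * (int a' - int a) \<in> int ` B"
      by (rule shift) (use a b in linarith)+
    then show "b \<in> int ` B" by (simp add: algebra_simps)
  qed
  then show ?thesis unfolding eventual_periods_def by blast
qed

text \<open>
  If \<open>a - a'\<close> were an eventual period, then \<open>b + a = (b + (a - a')) + a'\<close> would be two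
  representations of the same number.
\<close>

lemma difference_not_eventual_period:
  fixes A B :: "nat set"
  assumes A: "finite A" and tiling: "\<forall>\<^sub>F n in sequentially. card (reps A B n) = 1"
    and a: "a \<in> A" "a' \<in> A" "a \<noteq> a'"
  shows "int a - int a' \<notin> eventual_periods B"
proof
  assume "int a - int a' \<in> eventual_periods B"
  then obtain N where N: "\<And>b. b \<ge> N \<Longrightarrow> b + (int a - int a') \<in> int ` B \<longleftrightarrow> b \<in> int ` B"
    unfolding eventual_periods_def by blast
  obtain M where M: "\<And>n. n \<ge> M \<Longrightarrow> card (reps A B n) = 1"
    using tiling unfolding eventually_sequentially by blast
  obtain K where K: "\<And>a. a \<in> A \<Longrightarrow> a \<le> K"
    using A finite_nat_set_iff_bounded_le[of A] by auto
  \<comment> \<open>Any representation of a large number supplies a large element of \<open>B\<close>.\<close>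
  obtain c where "c \<in> reps A B (M + nat N + K)"
    using M[of "M + nat N + K"] by (metis card.empty equals0I le_add1 add.assoc zero_neq_one)
  moreover define b where "b = M + nat N + K - c"
  ultimately have "c \<in> A" "b \<in> B" by (auto simp: reps_def)
  then have "b \<ge> M + nat N" using K[of c] by (simp add: b_def)
  then have "int b + (int a - int a') \<in> int ` B" using N[of "int b"] \<open>b \<in> B\<close> by simp
  then obtain b' where b': "b' \<in> B" "int b + (int a - int a') = int b'" by blast
  then have "b + a = b' + a'" by linarith
  then have "b + a - a' = b'" "a' \<le> b + a" by linarith+
  then have "{a, a'} \<subseteq> reps A B (b + a)"
    using a b' \<open>b \<in> B\<close> by (simp add: reps_def)
  then have "card {a, a'} \<le> card (reps A B (b + a))"
    by (intro card_mono finite_reps A)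
  also have "\<dots> = 1" using M \<open>b \<ge> M + nat N\<close> by simp
  finally show False using a by simp
qed

text \<open>
  Subgroups of the integers are cyclic: divide with remainder by the least positive element.
\<close>

lemma int_subgroup_generator:
  fixes T :: "int set"
  assumes diff: "\<And>t u. t \<in> T \<Longrightarrow> u \<in> T \<Longrightarrow> t - u \<in> T"
    and nontrivial: "t0 \<in> T" "t0 \<noteq> 0"
  obtains t where "t > 0" "T = {u. t dvd u}"
proof -
  have zero: "0 \<in> T" using diff[OF nontrivial(1) nontrivial(1)] by simp
  have uminus: "- u \<in> T" if "u \<in> T" for u using diff[OF zero that] by simp
  have add: "t + u \<in> T" if "t \<in> T" "u \<in> T" for t u
    using diff[OF that(1) uminus[OF that(2)]] by simp
  have multiple_nat: "int k * u \<in> T" if "u \<in> T" for k u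
    by (induction k) (simp_all add: zero that add algebra_simps)
  have multiple: "k * u \<in> T" if "u \<in> T" for k u
    using multiple_nat[OF that, of "nat k"] uminus[OF multiple_nat[OF that, of "nat (- k)"]]
    by (cases "k \<ge> 0") simp_all
  have "int (nat \<bar>t0\<bar>) \<in> T \<and> nat \<bar>t0\<bar> > 0"
    using nontrivial uminus by (auto simp: abs_if)
  then obtain m where m: "int m \<in> T" "m > 0"
    and least: "\<And>k. k < m \<Longrightarrow> \<not> (int k \<in> T \<and> k > 0)"
    using exists_least_iff[of "\<lambda>k. int k \<in> T \<and> k > 0"] by blast
  have "int m dvd u" if "u \<in> T" for u
  proof -
    have "u mod int m = u - (u div int m) * int m" by (simp add: minus_div_mult_eq_mod)
    then have "u mod int m \<in> T" using diff[OF that multiple[OF m(1)]] by simp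
    moreover have bounds: "0 \<le> u mod int m" "u mod int m < int m" using m(2) by simp_all
    moreover have "nat (u mod int m) < m" using bounds by linarith
    ultimately have "\<not> 0 < nat (u mod int m)" using least[of "nat (u mod int m)"] by simp
    then have "u mod int m = 0" using bounds by linarith
    then show ?thesis by (simp add: dvd_eq_mod_eq_0)
  qed
  moreover have "u \<in> T" if "int m dvd u" for u
    using that multiple[OF m(1)] by (auto elim!: dvdE simp: mult.commute)
  ultimately show ?thesis using that[of "int m"] m(2) by auto
qed

section \<open>Sets of prime size with separated differences\<close>

text \<open>
  Let \<open>t = p\<^sup>m w\<close> with \<open>w\<close> prime to \<open>p\<close>. Then \<open>w\<close> divides every difference, so it is the power of
  \<open>p\<close> alone that prevents \<open>t\<close> from dividing a nonzero difference, while \<open>t\<close> dividing \<open>p(x - y)\<close>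
  loses at most one factor \<open>p\<close>. Hence \<open>s = m - 1\<close> works.
\<close>

lemma prime_power_separates:
  fixes S :: "int set" and t :: int
  assumes p: "prime p" and card: "card S = p" and t: "t > 0"
    and dvd: "\<And>x y. x \<in> S \<Longrightarrow> y \<in> S \<Longrightarrow> t dvd int p * (x - y)"
    and ndvd: "\<And>x y. x \<in> S \<Longrightarrow> y \<in> S \<Longrightarrow> x \<noteq> y \<Longrightarrow> \<not> t dvd x - y"
  obtains s where "\<And>x y. x \<in> S \<Longrightarrow> y \<in> S \<Longrightarrow> int p ^ s dvd x - y"
    and "\<And>x y. x \<in> S \<Longrightarrow> y \<in> S \<Longrightarrow> int p ^ (s + 1) dvd x - y \<Longrightarrow> x = y"
proof -
  have pz: "prime (int p)" using p by simp
  have "\<not> is_unit (int p)" using pz not_prime_unit by blast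
  obtain m w where w: "t = int p ^ m * w" "\<not> int p dvd w"
    using multiplicity_decompose'[of t "int p"] t \<open>\<not> is_unit (int p)\<close> by (metis less_irrefl)
  have cop: "coprime (int p ^ k) w" for k
    using prime_imp_coprime[OF pz w(2)] by simp
  have w_dvd: "w dvd x - y" if "x \<in> S" "y \<in> S" for x y
  proof -
    have "w dvd int p * (x - y)" using dvd[OF that] w(1) by (metis dvd_mult_right)
    then show ?thesis using cop[of 1] by (simp add: coprime_commute coprime_dvd_mult_right_iff)
  qed
  have sep: "x = y" if "x \<in> S" "y \<in> S" "int p ^ m dvd x - y" for x y
  proof (rule ccontr)
    assume "x \<noteq> y"
    have "t dvd x - y" unfolding w(1) using that w_dvd cop by (intro divides_mult) auto
    then show False using ndvd that \<open>x \<noteq> y\<close> by blast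
  qed
  have "\<exists>x\<in>S. \<exists>y\<in>S. x \<noteq> y"
  proof (rule ccontr)
    assume "\<not> ?thesis"
    then have "card S \<le> 1" by (metis card_le_Suc0_iff_eq card.infinite One_nat_def le0)
    then show False using card prime_gt_1_nat[OF p] by simp
  qed
  then have "m \<noteq> 0" using sep by (metis one_dvd power_0)
  then obtain s where s: "m = Suc s" by (cases m) auto
  have "int p ^ s dvd x - y" if "x \<in> S" "y \<in> S" for x y
  proof -
    have "int p * int p ^ s dvd int p * (x - y)"
      using dvd[OF that] w(1) unfolding s by (metis dvd_mult_left power_Suc)
    then show ?thesis using prime_gt_0_nat[OF p] by simp
  qed
  then show ?thesis using that[of s] sep s by simp
qed

text \<open>
  The quotients \<open>(x - a) / p\<^sup>s\<close> are \<open>p\<close> integers that are pairwise incongruent modulo \<open>p\<close>, hence a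
  complete residue system; \<open>k\<close> collects their integer parts after division by \<open>p\<close>.
\<close>

lemma prime_power_progression:
  fixes S :: "int set"
  assumes p: "prime p" and card: "card S = p"
    and cong: "\<And>x y. x \<in> S \<Longrightarrow> y \<in> S \<Longrightarrow> int p ^ s dvd x - y"
    and sep: "\<And>x y. x \<in> S \<Longrightarrow> y \<in> S \<Longrightarrow> int p ^ (s + 1) dvd x - y \<Longrightarrow> x = y"
    and a: "a0 \<in> S" "a0 \<ge> 0"
  shows "\<exists>a (s::nat) (k::nat \<Rightarrow> int). a > 0 \<and>
    S = {a + int i * int p ^ s + k i * int p ^ (s + 1) | i. i \<in> {0..p - 1}}"
proof -
  have p0: "p > 0" using p by (rule prime_gt_0_nat)
  have S: "finite S" using card p0 by (metis card.infinite less_irrefl)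
  \<comment> \<open>\<open>a0\<close> may be \<open>0\<close>; adding \<open>p\<^sup>s\<^sup>+\<^sup>1\<close> makes the base point positive without changing its class.\<close>
  define a where "a = a0 + int p ^ (s + 1)"
  define q where "q x = (x - a) div int p ^ s" for x
  have q: "x = a + q x * int p ^ s" if "x \<in> S" for x
  proof -
    have "int p ^ s dvd (x - a0) - int p ^ (s + 1)"
      by (rule dvd_diff[OF cong[OF that a(1)]]) simp
    also have "(x - a0) - int p ^ (s + 1) = x - a" by (simp add: a_def)
    finally have "int p ^ s dvd x - a" .
    then show ?thesis unfolding q_def by simp
  qed
  define r where "r x = nat (q x mod int p)" for x
  have r: "int (r x) = q x mod int p" for x using p0 by (simp add: r_def)
  have "inj_on r S"
  proof (rule inj_onI)
    fix x y assume xy: "x \<in> S" "y \<in> S" "r x = r y"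
    then have "int p dvd q x - q y" using r by (metis mod_eq_dvd_iff)
    then have "int p ^ (s + 1) dvd (q x - q y) * int p ^ s" by simp
    also have "(q x - q y) * int p ^ s = x - y"
      using q[OF xy(1)] q[OF xy(2)] by (simp add: algebra_simps)
    finally show "x = y" using sep xy by blast
  qed
  moreover have "r ` S \<subseteq> {0..p - 1}"
  proof
    fix i assume "i \<in> r ` S"
    then obtain x where "int i = q x mod int p" using r by auto
    then have "int i < int p" using p0 by simp
    then show "i \<in> {0..p - 1}" by auto
  qed
  ultimately have surj: "r ` S = {0..p - 1}"
    using card p0 by (intro card_subset_eq) (simp_all add: card_image)
  define k where "k i = q (the_inv_into S r i) div int p" for i
  have elem: "x = a + int (r x) * int p ^ s + k (r x) * int p ^ (s + 1)" if "x \<in> S" for x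
  proof -
    have "k (r x) = q x div int p" using the_inv_into_f_f[OF \<open>inj_on r S\<close> that] by (simp add: k_def)
    then have "q x = int (r x) + k (r x) * int p" unfolding r by simp
    then show ?thesis using q[OF that] by (simp add: algebra_simps)
  qed
  have "(\<lambda>i. a + int i * int p ^ s + k i * int p ^ (s + 1)) ` r ` S = (\<lambda>x. x) ` S"
    unfolding image_image by (rule image_cong[OF refl]) (rule elem[symmetric])
  then have "S = (\<lambda>i. a + int i * int p ^ s + k i * int p ^ (s + 1)) ` {0..p - 1}"
    unfolding surj by simp
  also have "\<dots> = {a + int i * int p ^ s + k i * int p ^ (s + 1) | i. i \<in> {0..p - 1}}"
    by (rule Setcompr_eq_image[symmetric])
  finally have "S = {a + int i * int p ^ s + k i * int p ^ (s + 1) | i. i \<in> {0..p - 1}}" .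
  moreover have "a > 0" using a p0 by (simp add: a_def add_nonneg_pos)
  ultimately show ?thesis by blast
qed

section \<open>Sets of prime size that tile eventually\<close>

lemma prime_tile_progression:
  fixes A B :: "nat set"
  assumes p: "prime p" and cardA: "card A = p"
    and tiling: "\<forall>\<^sub>F n in sequentially. card (reps A B n) = 1"
  shows "\<exists>a (s::nat) (k::nat \<Rightarrow> int). a > 0 \<and>
    int ` A = {a + int i * int p ^ s + k i * int p ^ (s + 1) | i. i \<in> {0..p - 1}}"
proof -
  have A: "finite A" using cardA prime_gt_0_nat[OF p] by (metis card.infinite less_irrefl)
  have "\<not> card A \<le> Suc 0" using cardA prime_gt_1_nat[OF p] by simp
  then obtain a b where ab: "a \<in> A" "b \<in> A" "a \<noteq> b"
    using card_le_Suc0_iff_eq[OF A] by blast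
  have "int p * (int a - int b) \<noteq> 0" using ab prime_gt_0_nat[OF p] by simp
  with eventual_period_p_difference[OF p cardA tiling ab(1,2)]
  obtain t where t: "t > 0" "eventual_periods B = {u. t dvd u}"
    using int_subgroup_generator[of "eventual_periods B"] eventual_periods_diff by blast
  have card: "card (int ` A) = p" using cardA by (simp add: card_image)
  obtain s where "\<And>x y. x \<in> int ` A \<Longrightarrow> y \<in> int ` A \<Longrightarrow> int p ^ s dvd x - y"
    and "\<And>x y. x \<in> int ` A \<Longrightarrow> y \<in> int ` A \<Longrightarrow> int p ^ (s + 1) dvd x - y \<Longrightarrow> x = y"
  proof (rule prime_power_separates[OF p card t(1)])
    fix x y assume "x \<in> int ` A" "y \<in> int ` A"
    then show "t dvd int p * (x - y)"
      using eventual_period_p_difference[OF p cardA tiling] t(2) by auto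
  next
    fix x y assume "x \<in> int ` A" "y \<in> int ` A" "x \<noteq> y"
    then show "\<not> t dvd x - y"
      using difference_not_eventual_period[OF A tiling] t(2) by auto
  qed blast
  then show ?thesis
    using ab(1) by (intro prime_power_progression[OF p card, of s "int a"]) auto
qed

theorem theorem1:
  fixes p :: nat and A B :: "nat set"
  assumes "prime p"
    and "card A = p"
    and "\<not> (\<exists>(a::int) (s::nat) (k::nat \<Rightarrow> int). a > 0 \<and>
           int ` A = {a + int i * int p ^ s + k i * int p ^ (s + 1) | i. i \<in> {0..p - 1}})"
    and "additive_complement A B"
  shows "filterlim (\<lambda>x::real. real (counting A x) * real (counting B x) - x) at_top at_top"
proof (rule surplus_tends_to_infinity)
  show A: "finite A" using assms(1,2) prime_gt_0_nat by (metis card.infinite less_irrefl)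
  show "infinite {n. card (reps A B n) \<ge> 2}"
  proof
    assume "finite {n. card (reps A B n) \<ge> 2}"
    then obtain M where M: "\<And>n. card (reps A B n) \<ge> 2 \<Longrightarrow> n \<le> M"
      by (auto simp: finite_nat_set_iff_bounded_le)
    obtain n0 where n0: "\<And>n. n \<ge> n0 \<Longrightarrow> reps A B n \<noteq> {}"
      using additive_complement_reps[OF assms(4)] by blast
    have "card (reps A B n) = 1" if "n \<ge> n0 + M + 1" for n
    proof -
      have "card (reps A B n) \<noteq> 0" using n0[of n] that finite_reps[OF A] by simp
      moreover have "\<not> card (reps A B n) \<ge> 2" using M[of n] that by auto
      ultimately show ?thesis by simp
    qed
    then have "\<forall>\<^sub>F n in sequentially. card (reps A B n) = 1"
      unfolding eventually_sequentially by blast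
    then show False using prime_tile_progression[OF assms(1,2)] assms(3) by blast
  qed
qed (rule assms(4))

end
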